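(* Let $G$ and $\overline{G}$ be any pair of twin $P$ games, and let $q$ and $\overline{q}$ be their respective minimal winning quotas. Then $q=\overline{q}$.
   Context: **Games.** Let $N=\{1,\dots,n\}$ be a set of players. A simple game is a function $v:\mathcal P(N)\to\{0,1\}$; a coalition $S\subseteq N$ is winning if $v(S)=1$, and minimal winning if $v(S)=1$ and $v(T)=0$ for every $T\subsetneq S$. The game is constant sum if $v(S)+v(N\setminus S)=1$ for all $S$. A player is a dummy if it belongs to no minimal winning coalition, and a dictator if $v(\{j\})=1$; all games considered are free of dummies and dictators. A representation $(q;\mathbf w)$ of a weighted majority game consists of positive weights $w_1,\dots,w_n$ and a quota $q>\tfrac12 w(N)$ such that $v(S)=1\iff w(S)\ge q$, where $w(S)=\sum_{j\in S}w_j$. It is homogeneous if $w(S)=q$ for every minimal winning $S$; a game is a homogeneous weighted majority game if it has a homogeneous representation. Every constant sum homogeneous weighted majority game has a (unique) minimal homogeneous representation: a homogeneous representation with integer weights, minimum weight $1$, and $q=\frac{1+w(N)}{2}$. The minimal winning quota of the game is the $q$ of this representation, and its individual weights are the $w_j$ of this representation. Players are always numbered so that $1=w_1\le w_2\le\dots\le w_n$ (standard ordering). **$P$ games.** A $P$ game (Parsimonious game) is a constant sum homogeneous weighted majority game with $n>3$ non-dummy players having exactly $n$ minimal winning coalitions (the smallest possible number). Players with the same individual weight are of the same type; types are numbered $t=1,\dots,h$ in strictly increasing order of weight. It is known that $2\le h\le n-2$, that type $h$ contains exactly one player (the top player, $j=n$), and that the minimal winning coalitions are exactly $S_1,\dots,S_n$,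 where for $j<n$ of type $t$ the coalition $S_j$ consists of $j$ and all players of type $s>t$ with $s-t$ odd, and $S_n$ consists of all players of odd type. **Incidence matrix.** The incidence matrix of a $P$ game is the $n\times n$ binary matrix $A=(a_{ij})$ with $a_{ij}=1$ if $j\in S_i$ and $a_{ij}=0$ otherwise. **Twins.** For any $P$ game $G$ with incidence matrix $A$, it is known that the transpose $A^T$ is again the incidence matrix of a $P$ game $\overline G$, called the twin of $G$, where in $A^T$ the non-top players (columns) and the corresponding coalitions (rows) are listed in the reverse of the standard order, while the top player and its associated coalition remain last. Equivalently, in the standard ordering the incidence matrix of $\overline G$ is $A^\tau$, obtained from $A^T$ by reversing the order of the first $n-1$ rows and of the first $n-1$ columns. Overlined quantities refer to $\overline G$. *)

theory Defs
  imports Complex_Main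
begin

abbreviation players :: "nat \<Rightarrow> nat set" where
  "players n \<equiv> {1..n}"

text \<open>A game on \<open>players n\<close> is a function on sets of naturals, of which only the values on
  subsets of \<open>players n\<close> are relevant.\<close>

definition simple_game :: "nat \<Rightarrow> (nat set \<Rightarrow> nat) \<Rightarrow> bool" where
  "simple_game n v \<longleftrightarrow> (\<forall>S. S \<subseteq> players n \<longrightarrow> v S \<in> {0, 1})"

definition minimal_winning :: "nat \<Rightarrow> (nat set \<Rightarrow> nat) \<Rightarrow> nat set \<Rightarrow> bool" where
  "minimal_winning n v S \<longleftrightarrow> S \<subseteq> players n \<and> v S = 1 \<and> (\<forall>T. T \<subset> S \<longrightarrow> v T = 0)"

definition constant_sum :: "nat \<Rightarrow> (nat set \<Rightarrow> nat) \<Rightarrow> bool" where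
  "constant_sum n v \<longleftrightarrow> (\<forall>S. S \<subseteq> players n \<longrightarrow> v S + v (players n - S) = 1)"

definition dummy :: "nat \<Rightarrow> (nat set \<Rightarrow> nat) \<Rightarrow> nat \<Rightarrow> bool" where
  "dummy n v j \<longleftrightarrow> \<not> (\<exists>S. minimal_winning n v S \<and> j \<in> S)"

definition dictator :: "(nat set \<Rightarrow> nat) \<Rightarrow> nat \<Rightarrow> bool" where
  "dictator v j \<longleftrightarrow> v {j} = 1"

definition representation ::
    "nat \<Rightarrow> (nat set \<Rightarrow> nat) \<Rightarrow> real \<Rightarrow> (nat \<Rightarrow> real) \<Rightarrow> bool" where
  "representation n v q w \<longleftrightarrow>
     (\<forall>j\<in>players n. w j > 0) \<and> q > sum w (players n) / 2 \<and>
     (\<forall>S. S \<subseteq> players n \<longrightarrow> (v S = 1 \<longleftrightarrow> sum w S \<ge> q))"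

definition homogeneous_representation ::
    "nat \<Rightarrow> (nat set \<Rightarrow> nat) \<Rightarrow> real \<Rightarrow> (nat \<Rightarrow> real) \<Rightarrow> bool" where
  "homogeneous_representation n v q w \<longleftrightarrow>
     representation n v q w \<and> (\<forall>S. minimal_winning n v S \<longrightarrow> sum w S = q)"

definition homogeneous_game :: "nat \<Rightarrow> (nat set \<Rightarrow> nat) \<Rightarrow> bool" where
  "homogeneous_game n v \<longleftrightarrow> (\<exists>q w. homogeneous_representation n v q w)"

definition minimal_homogeneous_representation ::
    "nat \<Rightarrow> (nat set \<Rightarrow> nat) \<Rightarrow> real \<Rightarrow> (nat \<Rightarrow> real) \<Rightarrow> bool" where
  "minimal_homogeneous_representation n v q w \<longleftrightarrow>
     homogeneous_representation n v q w \<and>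
     (\<forall>j\<in>players n. w j \<in> \<int>) \<and> Min (w ` players n) = 1 \<and>
     q = (1 + sum w (players n)) / 2"

definition minimal_winning_quota :: "nat \<Rightarrow> (nat set \<Rightarrow> nat) \<Rightarrow> real \<Rightarrow> bool" where
  "minimal_winning_quota n v q \<longleftrightarrow> (\<exists>w. minimal_homogeneous_representation n v q w)"

definition standard_ordering :: "nat \<Rightarrow> (nat \<Rightarrow> real) \<Rightarrow> bool" where
  "standard_ordering n w \<longleftrightarrow> mono_on (players n) w"

definition P_game :: "nat \<Rightarrow> (nat set \<Rightarrow> nat) \<Rightarrow> bool" where
  "P_game n v \<longleftrightarrow>
     n > 3 \<and> simple_game n v \<and> constant_sum n v \<and> homogeneous_game n v \<and>
     (\<forall>j\<in>players n. \<not> dummy n v j \<and> \<not> dictator v j) \<and>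
     card {S. minimal_winning n v S} = n"

text \<open>The type of player \<open>j\<close> is the rank of \<open>w j\<close> among the distinct individual weights.\<close>

definition player_type :: "nat \<Rightarrow> (nat \<Rightarrow> real) \<Rightarrow> nat \<Rightarrow> nat" where
  "player_type n w j = card {x \<in> w ` players n. x \<le> w j}"

text \<open>The coalitions \<open>S\<^sub>1, \<dots>, S\<^sub>n\<close>. That they are exactly the minimal winning coalitions of a
  P game with individual weights \<open>w\<close> (in standard ordering) is a theorem about P games and is
  not built into any definition here.\<close>

definition coalition :: "nat \<Rightarrow> (nat \<Rightarrow> real) \<Rightarrow> nat \<Rightarrow> nat set" where
  "coalition n w j =
     (if j < n
      then insert j {k \<in> players n. player_type n w k > player_type n w j \<and>
                                    odd (player_type n w k - player_type n w j)}
      else {k \<in> players n. odd (player_type n w k)})"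

text \<open>Matrices have indices in \<open>players n\<close>; entries outside this range are irrelevant.
  Since \<open>w\<close> is determined on \<open>players n\<close> by the game, so is the incidence matrix.\<close>

definition incidence_matrix ::
    "nat \<Rightarrow> (nat set \<Rightarrow> nat) \<Rightarrow> (nat \<Rightarrow> nat \<Rightarrow> nat) \<Rightarrow> bool" where
  "incidence_matrix n v A \<longleftrightarrow>
     (\<exists>q w. minimal_homogeneous_representation n v q w \<and> standard_ordering n w \<and>
        (\<forall>i\<in>players n. \<forall>j\<in>players n. A i j = (if j \<in> coalition n w i then 1 else 0)))"

definition reverse_non_top :: "nat \<Rightarrow> nat \<Rightarrow> nat" where
  "reverse_non_top n k = (if k < n then n - k else k)"

text \<open>\<open>A\<^sup>\<tau>\<close>: the transpose of \<open>A\<close> with its first \<open>n - 1\<close> rows and its first \<open>n - 1\<close> columns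
  in reverse order.\<close>

definition tau :: "nat \<Rightarrow> (nat \<Rightarrow> nat \<Rightarrow> nat) \<Rightarrow> nat \<Rightarrow> nat \<Rightarrow> nat" where
  "tau n A i j = A (reverse_non_top n j) (reverse_non_top n i)"

definition twin_P_games ::
    "nat \<Rightarrow> (nat set \<Rightarrow> nat) \<Rightarrow> (nat set \<Rightarrow> nat) \<Rightarrow> bool" where
  "twin_P_games n v v' \<longleftrightarrow>
     P_game n v \<and> P_game n v' \<and>
     (\<exists>A. incidence_matrix n v A \<and> incidence_matrix n v' (tau n A))"

end

theory Submission
  imports Defs
begin

text \<open>Suppose that every row of the incidence matrix \<open>A\<close> of \<open>G\<close> is a minimal winning coalition of
  \<open>G\<close>, and every row of \<open>tau n A\<close> one of the twin. Let \<open>w\<close>, \<open>w'\<close> be minimal homogeneous weights of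
  \<open>G\<close> and of its twin, and let \<open>y\<close> be \<open>w'\<close> with its non-top entries reversed. Homogeneity says
  \<open>A w = q 1\<close> and \<open>y\<^sup>T A = q' 1\<^sup>T\<close>, so that evaluating \<open>y\<^sup>T A w\<close> in both ways gives
  \<open>q w'(N) = q' w(N)\<close>. As \<open>w(N) = 2 q - 1\<close> and \<open>w'(N) = 2 q' - 1\<close>, this is \<open>q = q'\<close>.

  The substance is therefore the structure theorem for \<open>P\<close> games, lemma
  \<open>coalition_minimal_winning\<close>: the coalitions built from the alternation of types are minimal
  winning. Decide on the players one after the other, from the heaviest to the lightest, to
  include or to exclude them, as long as the set \<open>T\<close> chosen among the players above \<open>k\<close> is still
  losing but can be completed to a winning coalition by players from \<open>{1..k}\<close>. The leaves of this
  binary tree are the minimal winning coalitions. Homogeneity forces that including \<open>k\<close> never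
  overshoots the quota; so \<open>k\<close> can be included at every vertex, and the tree has one leaf more than
  it has branchings, that is, vertices where \<open>k\<close> can be excluded too. Since there
  are no dummies, each of the levels \<open>2, \<dots>, n\<close> has a branching
  (\<open>branching_nonempty\<close>); since there are only \<open>n\<close> leaves, it has exactly one (\<open>card_branching\<close>).
  By the constant sum property, complementation is an involution on the vertices of each level, and
  the uniqueness of the branching then leaves just one complementary pair on each of the levels
  \<open>2, \<dots>, n - 1\<close>: a set that player \<open>k\<close> completes to exactly the quota, and its complement.
  Following this pair down the tree (\<open>alternating_tail_exact\<close>), it stays the same when the weight
  does not change from one player to the next, and its members exchange their roles when the weight
  drops. That is the alternation of types.\<close>

section \<open>Types and alternating tails\<close>

text \<open>In a \<open>P\<close> game these are the players that complete player \<open>k\<close> to the coalition \<open>S\<^sub>k\<close>. The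
  next lemmas describe them by a recursion that descends from the top player, which is the form in
  which they come up in the tree.\<close>

definition alternating_tail :: "nat \<Rightarrow> (nat \<Rightarrow> real) \<Rightarrow> nat \<Rightarrow> nat set" where
  "alternating_tail n w k = {j \<in> players n. player_type n w j > player_type n w k \<and>
                                            odd (player_type n w j - player_type n w k)}"

lemma alternating_tail_cong: "w i = w j \<Longrightarrow> alternating_tail n w i = alternating_tail n w j"
  by (simp add: alternating_tail_def player_type_def)

lemma player_type_mono: "w i \<le> w j \<Longrightarrow> player_type n w i \<le> player_type n w j"
  unfolding player_type_def by (rule card_mono) auto

lemma player_type_Suc:
  assumes "mono_on (players n) w" "1 \<le> k" "k < n" "w k < w (Suc k)"
  shows "player_type n w (Suc k) = Suc (player_type n w k)"
proof -
  have "w j \<le> w k \<or> w j = w (Suc k)" if "j \<in> players n" "w j \<le> w (Suc k)" for j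
  proof (cases "j \<le> k")
    case True
    then show ?thesis using assms that by (auto intro: mono_onD)
  next
    case False
    then have "w (Suc k) \<le> w j" using that by (intro mono_onD[OF assms(1)]) auto
    then show ?thesis using that by simp
  qed
  then have "{x \<in> w ` players n. x \<le> w (Suc k)} = insert (w (Suc k)) {x \<in> w ` players n. x \<le> w k}"
    using assms by force
  then show ?thesis using assms by (simp add: player_type_def)
qed

lemma player_type_1:
  assumes "mono_on (players n) w" "1 \<le> n"
  shows "player_type n w 1 = 1"
proof -
  have "w 1 \<le> w j" if "j \<in> players n" for j
    using assms that by (auto intro: mono_onD)
  then have "{x \<in> w ` players n. x \<le> w 1} = {w 1}"
    using assms by force
  then show ?thesis by (simp add: player_type_def)
qed

lemma alternating_tail_top:
  assumes "mono_on (players n) w"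
  shows "alternating_tail n w n = {}"
proof -
  have "player_type n w j \<le> player_type n w n" if "j \<in> players n" for j
    using assms that by (intro player_type_mono) (auto intro: mono_onD)
  then show ?thesis by (fastforce simp: alternating_tail_def)
qed

text \<open>When the type changes, the parity of every difference to a later type flips.\<close>

lemma alternating_tail_step:
  assumes "mono_on (players n) w" "1 \<le> k" "k < n" "w k < w (Suc k)"
  shows "alternating_tail n w k = {k<..n} - alternating_tail n w (Suc k)"
proof -
  let ?t = "player_type n w"
  have suc: "?t (Suc k) = Suc (?t k)" by (rule player_type_Suc[OF assms])
  have below: "?t j \<le> ?t k" if "j \<in> players n" "j \<le> k" for j
    using assms that by (intro player_type_mono) (auto intro: mono_onD)
  have above: "Suc (?t k) \<le> ?t j" if "j \<in> players n" "k < j" for j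
    unfolding suc[symmetric] using assms that by (intro player_type_mono) (auto intro: mono_onD)
  show ?thesis
  proof (rule set_eqI)
    fix j
    show "j \<in> alternating_tail n w k \<longleftrightarrow> j \<in> {k<..n} - alternating_tail n w (Suc k)"
    proof (cases "j \<in> players n \<and> k < j")
      case True
      then obtain d where "?t j = Suc (?t k) + d" using above le_Suc_ex by blast
      then show ?thesis using True by (auto simp: alternating_tail_def suc)
    next
      case False
      then show ?thesis using below by (force simp: alternating_tail_def)
    qed
  qed
qed

lemma odd_types_eq:
  assumes "mono_on (players n) w" "1 \<le> n"
  shows "{j \<in> players n. odd (player_type n w j)} = players n - alternating_tail n w 1"
proof -
  have "1 \<le> player_type n w j" if "j \<in> players n" for j
  proof -
    have "player_type n w 1 \<le> player_type n w j"
      using assms that by (intro player_type_mono) (auto intro: mono_onD)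
    then show ?thesis using player_type_1[OF assms] by simp
  qed
  then show ?thesis
    unfolding alternating_tail_def player_type_1[OF assms] by fastforce
qed

section \<open>The tree of partial coalitions\<close>

text \<open>The weights of a \<open>P\<close> game. The assumption \<open>gap\<close> is the constant sum property: the complement
  of a losing coalition is winning, so a losing coalition stays below the quota by at least \<open>1\<close>.\<close>

locale parsimonious_weights =
  fixes n :: nat and w :: "nat \<Rightarrow> real" and q :: real
  assumes n_gt_3: "n > 3"
    and pos: "j \<in> players n \<Longrightarrow> 0 < w j"
    and mono: "mono_on (players n) w"
    and weight_1: "w 1 = 1"
    and total: "sum w (players n) = 2 * q - 1"
    and gap: "S \<subseteq> players n \<Longrightarrow> sum w S < q \<Longrightarrow> sum w S \<le> q - 1"
    and homogeneous: "S \<subseteq> players n \<Longrightarrow> q \<le> sum w S \<Longrightarrow>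
                        (\<And>j. j \<in> S \<Longrightarrow> sum w (S - {j}) < q) \<Longrightarrow> sum w S = q"
    and no_dummy: "j \<in> players n \<Longrightarrow> \<exists>S \<subseteq> players n. j \<in> S \<and> sum w S = q"
    and card_winning: "card {S. S \<subseteq> players n \<and> sum w S = q} = n"
begin

text \<open>The vertices of level \<open>k\<close>, at which the decision on player \<open>k\<close> is due.\<close>

definition vertices :: "nat \<Rightarrow> nat set set" where
  "vertices k = {T. T \<subseteq> {k<..n} \<and> sum w T < q \<and> q \<le> sum w T + sum w {1..k}}"

text \<open>A vertex where player \<open>k\<close> can be excluded as well as included.\<close>

definition branching :: "nat \<Rightarrow> nat set set" where
  "branching k = {T \<in> vertices k. q \<le> sum w T + sum w {1..<k}}"

text \<open>The vertices of level \<open>k\<close> together with the leaves already reached above level \<open>k\<close>.\<close>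

definition frontier :: "nat \<Rightarrow> nat set set" where
  "frontier k = {T. T \<subseteq> {k<..n} \<and> sum w T \<le> q \<and> q \<le> sum w T + sum w {1..k}}"

lemma weight_nonneg: "S \<subseteq> players n \<Longrightarrow> 0 \<le> sum w S"
  by (intro sum_nonneg) (use pos in force)

lemma weight_mono:
  assumes "S \<subseteq> R" "R \<subseteq> players n"
  shows "sum w S \<le> sum w R"
proof (rule sum_mono2)
  show "finite R" using assms(2) by (rule finite_subset) simp
  show "0 \<le> w j" if "j \<in> R - S" for j using pos[of j] that assms by auto
qed (rule assms(1))

lemma weight_le: "1 \<le> i \<Longrightarrow> i \<le> j \<Longrightarrow> j \<le> n \<Longrightarrow> w i \<le> w j"
  using mono by (auto intro: mono_onD)

lemma weight_upto: "1 \<le> k \<Longrightarrow> sum w {1..k} = sum w {1..<k} + w k"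
  by (cases k) (auto simp: atLeastLessThanSuc_atLeastAtMost)

lemma weight_complement:
  assumes "T \<subseteq> {k<..n}" "k \<le> n"
  shows "sum w ({k<..n} - T) = 2 * q - 1 - sum w {1..k} - sum w T"
proof -
  have "players n = {1..k} \<union> {k<..n}" using assms by auto
  then have "sum w (players n) = sum w {1..k} + sum w {k<..n}"
    using sum.union_disjoint[of "{1..k}" "{k<..n}" w] by fastforce
  moreover have "sum w ({k<..n} - T) = sum w {k<..n} - sum w T"
    using assms by (intro sum_diff) auto
  ultimately show ?thesis using total by simp
qed

text \<open>Including player \<open>k\<close> never overshoots the quota: all players of \<open>insert k T\<close> are at least as
  heavy as \<open>k\<close>, so if it overshot, this would be a minimal winning coalition of excessive weight.\<close>

lemma vertex_include_le:
  assumes "T \<in> vertices k" "1 \<le> k" "k \<le> n"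
  shows "sum w T + w k \<le> q"
proof (rule ccontr)
  assume *: "\<not> ?thesis"
  have T: "T \<subseteq> {k<..n}" "sum w T < q" using assms by (auto simp: vertices_def)
  then have fin: "finite T" and k: "k \<notin> T" by (auto intro: finite_subset)
  have "sum w (insert k T) = q"
  proof (rule homogeneous)
    show "insert k T \<subseteq> players n" using T assms by auto
    show "q \<le> sum w (insert k T)" using * fin k by simp
    fix j assume j: "j \<in> insert k T"
    then have "w k \<le> w j" using T assms by (intro weight_le) auto
    moreover have "sum w (insert k T - {j}) = sum w (insert k T) - w j"
      using fin j by (simp add: sum_diff1)
    ultimately show "sum w (insert k T - {j}) < q" using T fin k by simp
  qed
  then show False using * fin k by simp
qed

lemma vertex_complement:
  assumes "T \<in> vertices k" "k \<le> n"
  shows "{k<..n} - T \<in> vertices k"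
proof -
  have T: "T \<subseteq> {k<..n}" "sum w T < q" "q \<le> sum w T + sum w {1..k}"
    using assms by (auto simp: vertices_def)
  then have "sum w T \<le> q - 1" using assms by (intro gap) auto
  then show ?thesis
    using T weight_complement[OF T(1) assms(2)] by (auto simp: vertices_def)
qed

text \<open>A vertex without branching is complementary to one at which including \<open>k\<close> is a win.\<close>

lemma vertex_not_branching:
  assumes "T \<in> vertices k" "T \<notin> branching k" "1 \<le> k" "k \<le> n"
  shows "sum w ({k<..n} - T) + w k = q"
proof -
  have T: "T \<subseteq> {k<..n}" "sum w T + sum w {1..<k} < q"
    using assms by (auto simp: vertices_def branching_def)
  have "sum w (T \<union> {1..<k}) = sum w T + sum w {1..<k}"
    using T by (intro sum.union_disjoint) (auto intro: finite_subset)
  then have "sum w T + sum w {1..<k} \<le> q - 1"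
    using T assms gap[of "T \<union> {1..<k}"] by force
  moreover have "sum w ({k<..n} - T) + w k \<le> q"
    using assms by (intro vertex_include_le vertex_complement)
  ultimately show ?thesis
    using weight_complement[OF T(1) assms(4)] weight_upto[OF assms(3)] by simp
qed

text \<open>If no vertex of level \<open>k\<close> branched, then all of them would be completed to exactly the quota by
  player \<open>k\<close>, who would outweigh all lighter players taken together; so player \<open>1\<close> would be a dummy.\<close>

lemma branching_nonempty:
  assumes "2 \<le> k" "k \<le> n"
  shows "branching k \<noteq> {}"
proof
  assume none: "branching k = {}"
  obtain S where S: "S \<subseteq> players n" "1 \<in> S" "sum w S = q"
    using no_dummy[of 1] n_gt_3 by auto
  define T where "T = S \<inter> {k<..n}"
  define L where "L = S \<inter> {1..k}"
  have fin: "finite S" using S finite_subset by blast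
  have "S = T \<union> L" using S by (auto simp: T_def L_def)
  then have split: "sum w T + sum w L = q"
    using S(3) sum.union_disjoint[of T L w] fin by (fastforce simp: T_def L_def)
  have "sum w {1} \<le> sum w L" using S assms by (intro weight_mono) (auto simp: L_def)
  then have "1 \<le> sum w L" by (simp add: weight_1[simplified])
  moreover have "sum w L \<le> sum w {1..k}" using assms by (intro weight_mono) (auto simp: L_def)
  ultimately have T: "T \<in> vertices k" using split by (simp add: vertices_def T_def)
  have T': "{k<..n} - T \<in> vertices k" using T assms by (intro vertex_complement)
  have "{k<..n} - ({k<..n} - T) = T" by (auto simp: T_def)
  then have eq: "sum w T + w k = q"
    using vertex_not_branching[OF T'] none assms by simp
  have "sum w ({k<..n} - T) + w k = q"
    using vertex_not_branching[OF T] none assms by simp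
  then have "w k = sum w {1..<k} + 1"
    using eq weight_complement[of T k] weight_upto[of k] assms by (simp add: T_def)
  moreover have "sum w L = w k" using eq split by simp
  ultimately have "\<not> sum w L \<le> sum w {1..<k}" by simp
  then have "\<not> L \<subseteq> {1..<k}" using assms weight_mono[of L "{1..<k}"] by fastforce
  then obtain j where "j \<in> L" "j \<notin> {1..<k}" by blast
  then have "k \<in> L" by (cases "j = k") (auto simp: L_def)
  then have "sum w {1, k} \<le> sum w L"
    using S assms by (intro weight_mono) (auto simp: L_def)
  then show False using \<open>sum w L = w k\<close> assms by (simp add: weight_1[simplified])
qed

text \<open>A member of \<open>frontier (k - 1)\<close> that contains \<open>k\<close> comes from a vertex of level \<open>k\<close>; one that
  does not is a branching vertex or a leaf reached earlier.\<close>

lemma card_frontier_step: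
  assumes "1 \<le> k" "k \<le> n"
  shows "card (frontier (k - 1)) = card (frontier k) + card (branching k)"
proof -
  let ?won = "{T. T \<subseteq> {k<..n} \<and> sum w T = q}"
  have fin_Pow: "finite (Pow {k<..n})" by simp
  have fin: "finite (vertices k)" "finite (branching k)" "finite ?won"
    by (rule finite_subset[OF _ fin_Pow], auto simp: vertices_def branching_def)+
  have notin: "k \<notin> T" if "T \<in> vertices k" for T using that by (auto simp: vertices_def)
  have low: "{1..k - 1} = {1..<k}" using assms by auto
  have high: "{k - 1<..n} = insert k {k<..n}" using assms by auto
  have nonneg: "0 \<le> sum w {1..<k}" "0 \<le> sum w {1..k}" "0 < w k"
    using assms pos by (auto intro!: weight_nonneg)
  have insert_weight: "sum w (insert k T) = sum w T + w k" if "T \<subseteq> {k<..n}" for T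
    using that finite_subset[OF that] by (subst sum.insert) auto
  have "frontier k = vertices k \<union> ?won"
    using nonneg by (auto simp: frontier_def vertices_def)
  then have "card (frontier k) = card (vertices k) + card ?won"
    using fin by (simp add: card_Un_disjoint disjoint_iff vertices_def)
  moreover have "frontier (k - 1) = insert k ` vertices k \<union> (branching k \<union> ?won)"
    (is "_ = ?rhs")
  proof (intro set_eqI iffI)
    fix T assume T: "T \<in> frontier (k - 1)"
    show "T \<in> ?rhs"
    proof (cases "k \<in> T")
      case True
      define R where "R = T - {k}"
      have R: "T = insert k R" "R \<subseteq> {k<..n}"
        using T True high by (auto simp: R_def frontier_def)
      then have "R \<in> vertices k"
        using T insert_weight[OF R(2)] nonneg weight_upto[OF assms(1)]
        unfolding frontier_def vertices_def low by auto
      then show ?thesis using R by blast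
    next
      case False
      then have "T \<subseteq> {k<..n}" using T high by (auto simp: frontier_def)
      then show ?thesis
        using T nonneg weight_upto[OF assms(1)]
        unfolding frontier_def branching_def vertices_def low by auto
    qed
  next
    fix T assume "T \<in> ?rhs"
    then consider R where "T = insert k R" "R \<in> vertices k" | "T \<in> branching k" | "T \<in> ?won"
      by blast
    then show "T \<in> frontier (k - 1)"
    proof cases
      case 1
      then have R: "R \<subseteq> {k<..n}" by (simp add: vertices_def)
      show ?thesis
        using 1 R vertex_include_le[OF 1(2) assms] insert_weight[OF R] weight_upto[OF assms(1)]
        unfolding frontier_def vertices_def low high by auto
    next
      case 2
      then show ?thesis
        unfolding frontier_def branching_def vertices_def low high by auto
    next
      case 3
      then show ?thesis
        using nonneg unfolding frontier_def low high by auto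
    qed
  qed
  moreover have "card (insert k ` vertices k \<union> (branching k \<union> ?won))
      = card (insert k ` vertices k) + (card (branching k) + card ?won)"
  proof -
    have "insert k ` vertices k \<inter> (branching k \<union> ?won) = {}"
      by (auto simp: branching_def vertices_def)
    moreover have "branching k \<inter> ?won = {}" by (auto simp: branching_def vertices_def)
    ultimately show ?thesis using fin by (simp add: card_Un_disjoint)
  qed
  moreover have "card (insert k ` vertices k) = card (vertices k)"
    using notin by (intro card_image inj_onI) (metis insert_ident)
  ultimately show ?thesis by simp
qed

lemma quota_pos: "1 \<le> q"
proof -
  obtain S where "S \<subseteq> players n" "1 \<in> S" "sum w S = q"
    using no_dummy[of 1] n_gt_3 by auto
  then show ?thesis using weight_mono[of "{1}" S] by (simp add: weight_1[simplified])
qed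

text \<open>The tree has one root and \<open>n\<close> leaves, hence \<open>n - 1\<close> branchings; there is one at least on each of
  the \<open>n - 1\<close> levels \<open>2, \<dots>, n\<close>.\<close>

lemma card_branching:
  assumes "2 \<le> k" "k \<le> n"
  shows "card (branching k) = 1"
proof -
  have ge: "1 \<le> card (branching j)" if "2 \<le> j" "j \<le> n" for j
  proof -
    have "finite (branching j)"
      by (rule finite_subset[of _ "Pow {j<..n}"]) (auto simp: branching_def vertices_def)
    then show ?thesis using branching_nonempty[OF that] by (simp add: Suc_le_eq card_gt_0_iff)
  qed
  have telescope: "card (frontier 0) = card (frontier m) + (\<Sum>j = 1..m. card (branching j))"
    if "m \<le> n" for m
    using that
  proof (induction m)
    case (Suc m)
    then show ?case using card_frontier_step[of "Suc m"] by simp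
  qed simp
  have "frontier n = {{}}"
    using quota_pos total by (auto simp: frontier_def)
  moreover have "frontier 0 = {S. S \<subseteq> players n \<and> sum w S = q}"
    by (auto simp: frontier_def)
  ultimately have "(\<Sum>j = 1..n. card (branching j)) = n - 1"
    using telescope[of n] card_winning by simp
  then have "(\<Sum>j = 2..n. card (branching j)) \<le> n - 1"
    using sum_mono2[of "{1..n}" "{2..n}" "\<lambda>j. card (branching j)"] by simp
  moreover have "(\<Sum>j = 2..n. card (branching j))
      = card (branching k) + (\<Sum>j \<in> {2..n} - {k}. card (branching j))"
    using assms by (simp add: sum.remove)
  moreover have "(\<Sum>j \<in> {2..n} - {k}. 1) \<le> (\<Sum>j \<in> {2..n} - {k}. card (branching j))"
    using ge by (intro sum_mono) auto
  moreover have "(\<Sum>j \<in> {2..n} - {k}. (1::nat)) = n - 2"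
    using assms by simp
  ultimately show ?thesis using ge[OF assms] n_gt_3 by linarith
qed

section \<open>The complementary pair on each level\<close>

lemma weight_le_lower:
  assumes "2 \<le> k" "k \<le> n"
  shows "w k \<le> sum w {1..<k}"
proof -
  obtain T where "T \<in> branching k" using branching_nonempty[OF assms] by blast
  then show ?thesis
    using vertex_include_le[of T k] assms by (auto simp: branching_def)
qed

text \<open>A vertex that \<open>k\<close> completes to exactly the quota branches by \<open>weight_le_lower\<close>, and there is
  only one branching.\<close>

lemma exact_unique:
  assumes "2 \<le> k" "k \<le> n" "T \<in> vertices k" "sum w T + w k = q"
    and "R \<in> vertices k" "sum w R + w k = q"
  shows "T = R"
proof -
  have "T \<in> branching k" "R \<in> branching k"
    using assms weight_le_lower[of k] by (auto simp: branching_def)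
  then show ?thesis using card_branching[OF assms(1,2)] by (metis card_1_singletonE singletonD)
qed

text \<open>A vertex and its complement cannot both be branching, so \<open>vertex_not_branching\<close> applies to one
  of them.\<close>

lemma exact_or_complement_exact:
  assumes "2 \<le> k" "k < n" "T \<in> vertices k"
  shows "sum w T + w k = q \<or> sum w ({k<..n} - T) + w k = q"
proof (cases "T \<in> branching k")
  case False
  then show ?thesis using vertex_not_branching[of T k] assms by simp
next
  case True
  have T: "T \<subseteq> {k<..n}" using assms by (simp add: vertices_def)
  have "{k<..n} - T \<noteq> T" using T assms by auto
  then have "{k<..n} - T \<notin> branching k"
    using True card_branching[of k] assms by (metis card_1_singletonE less_imp_le singletonD)
  moreover have "{k<..n} - ({k<..n} - T) = T" using T by auto
  ultimately show ?thesis
    using vertex_not_branching[OF vertex_complement[OF assms(3)]] assms by simp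
qed

lemma exact_not_both:
  assumes "2 \<le> k" "k < n" "T \<in> vertices k" "sum w T + w k = q"
  shows "sum w ({k<..n} - T) + w k \<noteq> q"
proof
  assume "sum w ({k<..n} - T) + w k = q"
  then have eq: "T = {k<..n} - T"
    using exact_unique[OF assms(1) less_imp_le[OF assms(2)] assms(3,4)]
      vertex_complement[OF assms(3) less_imp_le[OF assms(2)]] by blast
  have "n \<in> {k<..n}" using assms(2) by simp
  then have "n \<in> T \<longleftrightarrow> n \<notin> {k<..n} - T" by simp
  then show False unfolding eq[symmetric] by simp
qed

text \<open>Excluding \<open>k\<close> at the vertex that \<open>k\<close> would complete.\<close>

lemma exact_descends:
  assumes "2 \<le> Suc k" "Suc k \<le> n" "T \<in> vertices (Suc k)" "sum w T + w (Suc k) = q"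
  shows "T \<in> vertices k"
proof -
  have "{1..<Suc k} = {1..k}" by auto
  then have "w (Suc k) \<le> sum w {1..k}" using weight_le_lower[OF assms(1,2)] by simp
  moreover have "T \<subseteq> {k<..n}" "sum w T < q" using assms(3) by (auto simp: vertices_def)
  ultimately show ?thesis using assms(4) by (simp add: vertices_def)
qed

text \<open>The vertex \<open>{}\<close> of level \<open>n - 1\<close> cannot be the exact one, because no player wins alone.\<close>

lemma top_pair:
  shows "{n} \<in> vertices (n - 1)" "w n + w (n - 1) = q"
proof -
  have n: "{n - 1<..n} = {n}" "Suc (n - 1) = n" "{1..<n} = {1..n - 1}" using n_gt_3 by auto
  obtain T where "T \<in> branching n" using branching_nonempty[of n] n_gt_3 by auto
  then have le: "q \<le> sum w {1..n - 1}" unfolding branching_def vertices_def n(3) by auto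
  then have empty: "{} \<in> vertices (n - 1)" using quota_pos by (auto simp: vertices_def)
  then show "{n} \<in> vertices (n - 1)" using vertex_complement[of "{}" "n - 1"] n by simp
  have "w (n - 1) \<le> w n" using n_gt_3 by (intro weight_le) auto
  moreover have "w n < q" using le total weight_upto[of n] n n_gt_3 by simp
  ultimately show "w n + w (n - 1) = q"
    using exact_or_complement_exact[OF _ _ empty] n n_gt_3 by auto
qed

text \<open>If the two heaviest players had equal weights, then \<open>{n}\<close> and \<open>{n - 1}\<close>, complementary
  vertices on level \<open>n - 2\<close>, would both be exact.\<close>

lemma top_unique: "w (n - 1) < w n"
proof (rule ccontr)
  assume "\<not> ?thesis"
  moreover have "w (n - 1) \<le> w n" using n_gt_3 by (intro weight_le) auto
  ultimately have eq: "w (n - 1) = w n" by simp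
  have level: "2 \<le> n - 2" "n - 2 < n" using n_gt_3 by auto
  have n: "Suc (n - 2) = n - 1" "{n - 2<..n} - {n} = {n - 1}" using n_gt_3 by auto
  have V: "{n} \<in> vertices (n - 2)"
    using exact_descends[of "n - 2" "{n}"] top_pair n n_gt_3 by simp
  then have "w n + w (n - 2) = q"
    using exact_or_complement_exact[OF level V] n eq by auto
  then show False
    using exact_not_both[OF level V] n eq by simp
qed

text \<open>The exact vertex of level \<open>k + 1\<close> is also a vertex of level \<open>k\<close>, so it is the exact one there or
  the complement of the exact one. The first case means equal weights and an unchanged
  tail; in the second the weight drops, and the tail is complemented.\<close>

theorem alternating_tail_exact:
  assumes "2 \<le> k" "k < n"
  shows "alternating_tail n w k \<in> vertices k \<and> sum w (alternating_tail n w k) + w k = q"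
proof -
  have "k \<le> n - 1" using assms by simp
  then show ?thesis using assms(1)
  proof (induction rule: inc_induct)
    case base
    have "alternating_tail n w (n - 1) = {n}"
      using alternating_tail_step[OF mono, of "n - 1"] alternating_tail_top[OF mono]
        top_unique n_gt_3 by auto
    then show ?case using top_pair by simp
  next
    case (step k)
    let ?T = "alternating_tail n w (Suc k)"
    have T: "?T \<in> vertices (Suc k)" "sum w ?T + w (Suc k) = q" using step by auto
    have V: "?T \<in> vertices k" using exact_descends[OF _ _ T] step by simp
    have le: "w k \<le> w (Suc k)" using step by (intro weight_le) auto
    have level: "2 \<le> k" "k < n" using step by auto
    consider "sum w ?T + w k = q" | "sum w ({k<..n} - ?T) + w k = q"
      using exact_or_complement_exact[OF level V] by blast
    then show ?case
    proof cases
      case 1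
      then have "w k = w (Suc k)" using T by simp
      then show ?thesis using 1 V alternating_tail_cong by metis
    next
      case 2
      have "w k \<noteq> w (Suc k)" using exact_not_both[OF level V] T 2 by metis
      then have "alternating_tail n w k = {k<..n} - ?T"
        using le level by (intro alternating_tail_step[OF mono]) auto
      then show ?thesis using 2 vertex_complement[OF V] level by simp
    qed
  qed
qed

text \<open>Level \<open>1\<close> inherits the pair of level \<open>2\<close>, because the second weight is \<open>1\<close> too; both members
  of the pair are completed by player \<open>1\<close>, and this accounts for the two coalitions \<open>S\<^sub>1\<close> and
  \<open>S\<^sub>n\<close>.\<close>

theorem weight_coalition:
  assumes "i \<in> players n"
  shows "sum w (coalition n w i) = q"
proof -
  let ?A = "alternating_tail n w"
  have "w 2 \<le> 1" using weight_le_lower[of 2] n_gt_3 weight_1 by (simp add: numeral_2_eq_2)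
  moreover have "w 1 \<le> w 2" using n_gt_3 by (intro weight_le) auto
  ultimately have w2: "w 1 = w 2" "w 2 = 1" using weight_1 by auto
  have exact2: "?A 2 \<in> vertices 2" "sum w (?A 2) + w 2 = q"
    using alternating_tail_exact[of 2] n_gt_3 by auto
  have A1: "?A 1 = ?A 2" using w2 alternating_tail_cong by blast
  show ?thesis
  proof (cases "i < n")
    case True
    have "?A i \<subseteq> {i<..n} \<and> sum w (?A i) + w i = q"
    proof (cases "i = 1")
      case True
      then show ?thesis using exact2 A1 w2 by (auto simp: vertices_def)
    next
      case False
      then show ?thesis
        using alternating_tail_exact[of i] assms True by (auto simp: vertices_def)
    qed
    then have "sum w (insert i (?A i)) = q"
      by (subst sum.insert) (auto intro: finite_subset)
    then show ?thesis using True by (simp add: coalition_def alternating_tail_def)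
  next
    case False
    then have "coalition n w i = players n - ?A 1"
      using odd_types_eq[OF mono] n_gt_3 by (simp add: coalition_def)
    moreover have "sum w (players n - ?A 1) = sum w (players n) - sum w (?A 1)"
      by (intro sum_diff) (auto simp: alternating_tail_def)
    ultimately show ?thesis using total exact2 A1 w2 by simp
  qed
qed

end

section \<open>The minimal winning coalitions of a P game\<close>

lemma coalition_subset: "i \<in> players n \<Longrightarrow> coalition n w i \<subseteq> players n"
  by (auto simp: coalition_def)

lemma losing_if_below_quota:
  assumes "simple_game n v" "representation n v q w" "S \<subseteq> players n" "sum w S < q"
  shows "v S = 0"
proof -
  have "v S \<noteq> 1" using assms(2-4) by (simp add: representation_def)
  moreover have "v S \<in> {0, 1}" using assms(1,3) unfolding simple_game_def by blast
  ultimately show ?thesis by simp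
qed

lemma minimal_winning_iff:
  assumes "simple_game n v" "homogeneous_representation n v q w"
  shows "minimal_winning n v S \<longleftrightarrow> S \<subseteq> players n \<and> sum w S = q"
proof
  assume "minimal_winning n v S"
  then show "S \<subseteq> players n \<and> sum w S = q"
    using assms by (auto simp: homogeneous_representation_def minimal_winning_def)
next
  assume S: "S \<subseteq> players n \<and> sum w S = q"
  have rep: "representation n v q w" using assms by (simp add: homogeneous_representation_def)
  have "v T = 0" if "T \<subset> S" for T
  proof -
    have "sum w T < sum w S"
    proof -
      obtain j where j: "j \<in> S" "j \<notin> T" using psubset_imp_ex_mem[OF \<open>T \<subset> S\<close>] by blast
      have "finite S" using S finite_subset[of S "players n"] by simp
      then show ?thesis
        using rep S that j
        by (intro sum_strict_mono2[of S T j]) (auto simp: representation_def intro: less_imp_le)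
    qed
    moreover have "T \<subseteq> players n" using that S by auto
    ultimately show ?thesis using losing_if_below_quota[OF assms(1) rep] S by simp
  qed
  then show "minimal_winning n v S"
    using S rep by (auto simp: minimal_winning_def representation_def)
qed

lemma P_game_parsimonious_weights:
  assumes "P_game n v" "minimal_homogeneous_representation n v q w" "standard_ordering n w"
  shows "parsimonious_weights n w q"
proof
  have hom: "homogeneous_representation n v q w" and rep: "representation n v q w"
    using assms by (auto simp: minimal_homogeneous_representation_def homogeneous_representation_def)
  have simple: "simple_game n v" using assms by (simp add: P_game_def)
  note mw = minimal_winning_iff[OF simple hom]
  show n: "n > 3" using assms by (simp add: P_game_def)
  show "0 < w j" if "j \<in> players n" for j using rep that by (simp add: representation_def)
  show mono: "mono_on (players n) w" using assms by (simp add: standard_ordering_def)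
  have "Min (w ` players n) = w 1"
    using n mono by (intro Min_eqI) (auto intro: mono_onD)
  then show "w 1 = 1" using assms by (simp add: minimal_homogeneous_representation_def)
  show total: "sum w (players n) = 2 * q - 1"
    using assms by (simp add: minimal_homogeneous_representation_def)
  show "sum w S \<le> q - 1" if "S \<subseteq> players n" "sum w S < q" for S
  proof -
    have "v S = 0" by (rule losing_if_below_quota[OF simple rep that])
    then have "v (players n - S) = 1"
      using assms that by (auto simp: P_game_def constant_sum_def)
    then have "q \<le> sum w (players n - S)" using rep by (simp add: representation_def)
    then show ?thesis using that total by (simp add: sum_diff)
  qed
  show "sum w S = q" if S: "S \<subseteq> players n" "q \<le> sum w S"
    and critical: "\<And>j. j \<in> S \<Longrightarrow> sum w (S - {j}) < q" for S
  proof -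
    have fin: "finite S" using S(1) by (rule finite_subset) simp
    have "v T = 0" if T: "T \<subset> S" for T
    proof -
      obtain j where j: "j \<in> S" "T \<subseteq> S - {j}" using T by blast
      have "sum w T \<le> sum w (S - {j})"
        using j(2) S(1) rep fin
        by (intro sum_mono2) (auto simp: representation_def intro: less_imp_le)
      then have "sum w T < q" using critical[OF j(1)] by simp
      moreover have "T \<subseteq> players n" using T S by auto
      ultimately show ?thesis by (intro losing_if_below_quota[OF simple rep])
    qed
    moreover have "v S = 1" using rep S by (simp add: representation_def)
    ultimately have "minimal_winning n v S" using S by (simp add: minimal_winning_def)
    then show ?thesis using mw by simp
  qed
  show "\<exists>S \<subseteq> players n. j \<in> S \<and> sum w S = q" if "j \<in> players n" for j
  proof -
    have "\<not> dummy n v j" using assms(1) that by (simp add: P_game_def)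
    then show ?thesis unfolding dummy_def mw by blast
  qed
  show "card {S. S \<subseteq> players n \<and> sum w S = q} = n"
    using assms(1) unfolding P_game_def mw by blast
qed

text \<open>By \<open>minimal_winning_iff\<close> it is enough that the coalitions have the weight of the quota.\<close>

theorem coalition_minimal_winning:
  assumes "P_game n v" "minimal_homogeneous_representation n v q w" "standard_ordering n w"
    and "i \<in> players n"
  shows "minimal_winning n v (coalition n w i)"
proof -
  interpret parsimonious_weights n w q by (rule P_game_parsimonious_weights[OF assms(1-3)])
  have "simple_game n v" "homogeneous_representation n v q w"
    using assms by (auto simp: P_game_def minimal_homogeneous_representation_def)
  then show ?thesis
    using minimal_winning_iff weight_coalition[OF assms(4)] coalition_subset[OF assms(4)] by blast
qed

section \<open>Quotas of twin games\<close>

text \<open>The weights \<open>w\<close> need not be the ones that \<open>A\<close> is built from: the rows are minimal winning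
  coalitions of the game, and homogeneity of any representation applies to them.\<close>

lemma incidence_matrix_row:
  assumes "P_game n v" "incidence_matrix n v A" "homogeneous_representation n v q w"
    and "i \<in> players n"
  shows "(\<Sum>j \<in> players n. real (A i j) * w j) = q"
proof -
  obtain p u where u: "minimal_homogeneous_representation n v p u" "standard_ordering n u"
    and A: "\<And>j. j \<in> players n \<Longrightarrow> A i j = (if j \<in> coalition n u i then 1 else 0)"
    using assms by (auto simp: incidence_matrix_def)
  have "(\<Sum>j \<in> players n. real (A i j) * w j)
      = (\<Sum>j \<in> players n. if j \<in> coalition n u i then w j else 0)"
    by (intro sum.cong) (auto simp: A)
  also have "\<dots> = sum w (coalition n u i)"
    using coalition_subset[OF assms(4)] by (simp add: sum.If_cases Int_absorb1)
  also have "\<dots> = q"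
    using coalition_minimal_winning[OF assms(1) u assms(4)] assms(3)
    by (simp add: homogeneous_representation_def)
  finally show ?thesis .
qed

lemma reverse_non_top_in: "j \<in> players n \<Longrightarrow> reverse_non_top n j \<in> players n"
  by (auto simp: reverse_non_top_def)

lemma reverse_non_top_involution:
  "j \<in> players n \<Longrightarrow> reverse_non_top n (reverse_non_top n j) = j"
  by (auto simp: reverse_non_top_def)

lemma sum_reverse_non_top:
  "(\<Sum>j \<in> players n. f (reverse_non_top n j)) = (\<Sum>j \<in> players n. f j)"
  by (rule sum.reindex_bij_witness[of _ "reverse_non_top n" "reverse_non_top n"])
     (simp_all only: reverse_non_top_in reverse_non_top_involution)

text \<open>The rows of \<open>tau n A\<close> are the columns of \<open>A\<close>, up to the reversal.\<close>

lemma tau_row: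
  assumes "\<And>i. i \<in> players n \<Longrightarrow> (\<Sum>j \<in> players n. real (tau n A i j) * y j) = q"
    and "j \<in> players n"
  shows "(\<Sum>i \<in> players n. real (A i j) * y (reverse_non_top n i)) = q"
proof -
  let ?r = "reverse_non_top n"
  have "(\<Sum>i \<in> players n. real (A i j) * y (?r i))
      = (\<Sum>i \<in> players n. real (A (?r i) j) * y (?r (?r i)))"
    by (rule sum_reverse_non_top[symmetric])
  also have "\<dots> = (\<Sum>i \<in> players n. real (tau n A (?r j) i) * y i)"
    using assms(2) by (intro sum.cong refl) (simp only: tau_def reverse_non_top_involution)
  also have "\<dots> = q" using assms by (simp only: reverse_non_top_in)
  finally show ?thesis .
qed

theorem theorem4p1:
  fixes n :: nat and G G' :: "nat set \<Rightarrow> nat" and q q' :: real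
  assumes "twin_P_games n G G'"
    and "minimal_winning_quota n G q"
    and "minimal_winning_quota n G' q'"
  shows "q = q'"
proof -
  let ?N = "players n" and ?r = "reverse_non_top n"
  obtain A where P: "P_game n G" "P_game n G'"
    and A: "incidence_matrix n G A" "incidence_matrix n G' (tau n A)"
    using assms(1) by (auto simp: twin_P_games_def)
  obtain w w' where "minimal_homogeneous_representation n G q w"
    and "minimal_homogeneous_representation n G' q' w'"
    using assms(2,3) by (auto simp: minimal_winning_quota_def)
  then have hom: "homogeneous_representation n G q w" "homogeneous_representation n G' q' w'"
    and total: "sum w ?N = 2 * q - 1" "sum w' ?N = 2 * q' - 1"
    by (simp_all add: minimal_homogeneous_representation_def)
  have row: "(\<Sum>j \<in> ?N. real (A i j) * w j) = q" if "i \<in> ?N" for i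
    using incidence_matrix_row[OF P(1) A(1) hom(1) that] .
  have column: "(\<Sum>i \<in> ?N. real (A i j) * w' (?r i)) = q'" if "j \<in> ?N" for j
    using tau_row[OF incidence_matrix_row[OF P(2) A(2) hom(2)] that] .
  have "(2 * q' - 1) * q = (\<Sum>i \<in> ?N. w' (?r i)) * q"
    by (simp only: sum_reverse_non_top total)
  also have "\<dots> = (\<Sum>i \<in> ?N. \<Sum>j \<in> ?N. w' (?r i) * (real (A i j) * w j))"
    by (simp only: sum_distrib_right sum_distrib_left[symmetric] row cong: sum.cong)
  also have "\<dots> = (\<Sum>j \<in> ?N. \<Sum>i \<in> ?N. w' (?r i) * (real (A i j) * w j))"
    by (rule sum.swap)
  also have "\<dots> = (\<Sum>j \<in> ?N. (\<Sum>i \<in> ?N. real (A i j) * w' (?r i)) * w j)"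
    by (intro sum.cong refl) (simp add: sum_distrib_left mult_ac)
  also have "\<dots> = q' * (2 * q - 1)"
    by (simp only: column sum_distrib_left[symmetric] total cong: sum.cong)
  finally show ?thesis by (simp add: algebra_simps)
qed

end
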